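(* Let $k$ and $\Delta$ be integers with $k\ge 1$, $\Delta\ge 4$, and $\Delta$ even. Then there exists a planar graph $J_{\Delta,k}$ with maximum degree $\Delta$ and girth at least $k$ such that $\chi_{\mathrm{os}}(J_{\Delta,k})=6$.
   Context: Graphs are finite, simple and undirected. For a vertex $v$ of a graph $G$, $N(v)=\{x: vx\in E(G)\}$ and $N[v]=N(v)\cup\{v\}$. A coloring of $G$ is a map $f:V(G)\to\mathbb{Z}^+$ (positive integers) such that $f(v)\ne f(w)$ for all $vw\in E(G)$. A coloring $f$ is an odd-sum coloring if $\sum_{w\in N[v]}f(w)$ is odd for each vertex $v\in V(G)$. The odd-sum chromatic number $\chi_{\mathrm{os}}(G)$ is the minimum size of the range of an odd-sum coloring of $G$ (it is known that every finite graph has an odd-sum coloring). The girth of a graph is the length of its shortest cycle. *)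

theory Defs
  imports "HOL-Analysis.Analysis" "Graph_Theory.Pair_Digraph"
begin

text \<open>
  A finite simple undirected graph is a \<^term>\<open>G :: 'a pair_pre_digraph\<close> satisfying \<^const>\<open>pair_graph\<close>:
  finitely many vertices and a symmetric, irreflexive set of arcs, so that an edge \<open>vw\<close> is
  represented by the two arcs \<open>(v, w)\<close> and \<open>(w, v)\<close>.  The definitions below are meant for such \<open>G\<close>.
\<close>

definition nbhd :: "'a pair_pre_digraph \<Rightarrow> 'a \<Rightarrow> 'a set" where
  "nbhd G v = {x. (v, x) \<in> parcs G}"

definition closed_nbhd :: "'a pair_pre_digraph \<Rightarrow> 'a \<Rightarrow> 'a set" where
  "closed_nbhd G v = nbhd G v \<union> {v}"

definition coloring :: "'a pair_pre_digraph \<Rightarrow> ('a \<Rightarrow> nat) \<Rightarrow> bool" where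
  "coloring G f \<longleftrightarrow>
     (\<forall>v \<in> pverts G. 0 < f v) \<and> (\<forall>(v, w) \<in> parcs G. f v \<noteq> f w)"

definition odd_sum_coloring :: "'a pair_pre_digraph \<Rightarrow> ('a \<Rightarrow> nat) \<Rightarrow> bool" where
  "odd_sum_coloring G f \<longleftrightarrow>
     coloring G f \<and> (\<forall>v \<in> pverts G. odd (\<Sum>w \<in> closed_nbhd G v. f w))"

text \<open>
  A coloring is only relevant on the vertices of \<open>G\<close>, so its range is the image of the vertex set.
  The infimum of a nonempty set of natural numbers is its minimum.
\<close>

definition odd_sum_chromatic_number :: "'a pair_pre_digraph \<Rightarrow> nat" where
  "odd_sum_chromatic_number G = Inf {card (f ` pverts G) | f. odd_sum_coloring G f}"

definition max_degree :: "'a pair_pre_digraph \<Rightarrow> nat" where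
  "max_degree G = Max ((\<lambda>v. card (nbhd G v)) ` pverts G)"

text \<open>
  In a symmetric digraph, \<^const>\<open>pre_digraph.cycle\<close> also admits the closed walks \<open>u, v, u\<close> that
  traverse an edge back and forth; these are the only ones of length less than 3 in a simple graph.
  Acyclic graphs have girth \<open>\<infinity>\<close>.
\<close>

definition girth :: "'a pair_pre_digraph \<Rightarrow> enat" where
  "girth G = Inf {enat (length p) | p. pre_digraph.cycle (with_proj G) p \<and> 3 \<le> length p}"

text \<open>
  A plane drawing places the vertices at distinct points and draws each edge as a simple arc between
  its ends.  The two arcs representing an edge are drawn as the same curve.  An edge meets no
  vertex other than its ends, and two edges meet only in common ends.
\<close>

definition plane_drawing ::
    "'a pair_pre_digraph \<Rightarrow> ('a \<Rightarrow> complex) \<Rightarrow> ('a \<Rightarrow> 'a \<Rightarrow> real \<Rightarrow> complex) \<Rightarrow> bool" where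
  "plane_drawing G pos \<gamma> \<longleftrightarrow>
     inj_on pos (pverts G) \<and>
     (\<forall>(u, v) \<in> parcs G.
        arc (\<gamma> u v) \<and> pathstart (\<gamma> u v) = pos u \<and> pathfinish (\<gamma> u v) = pos v \<and>
        path_image (\<gamma> v u) = path_image (\<gamma> u v)) \<and>
     (\<forall>(u, v) \<in> parcs G. \<forall>w \<in> pverts G. pos w \<in> path_image (\<gamma> u v) \<longrightarrow> w \<in> {u, v}) \<and>
     (\<forall>(u, v) \<in> parcs G. \<forall>(x, y) \<in> parcs G. {u, v} \<noteq> {x, y} \<longrightarrow>
        path_image (\<gamma> u v) \<inter> path_image (\<gamma> x y) \<subseteq> pos ` ({u, v} \<inter> {x, y}))"

definition planar :: "'a pair_pre_digraph \<Rightarrow> bool" where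
  "planar G \<longleftrightarrow> (\<exists>pos \<gamma>. plane_drawing G pos \<gamma>)"

end

theory Submission
  imports Defs
begin

text \<open>
  Only parities matter for the sum condition, and a colouring with odd colours on \<open>S\<close> and even
  colours elsewhere uses at least as many colours as the chromatic numbers of the two graphs induced
  by \<open>S\<close> and by its complement together.  Six colours are therefore forced as soon as every
  admissible \<open>S\<close> contains an odd cycle and so does its complement.  Two disjoint planar gadgets of
  maximum degree at most 3 achieve this, both built on a cycle of length \<open>n\<close>, where \<open>n\<close> is odd and
  large and not divisible by 3.

  \<^item> The first is the bare cycle, the ring.  The sum over any three consecutive colours is odd, so
    the parities have period 3.  They also have period \<open>n\<close>, hence they are constant, and three equal
    parities with an odd sum are odd (\<open>odd_window_sums_imp_all_odd\<close>).

  \<^item> The second is a cycle, the rim, with a path of two further vertices, a stem and a tip, hanging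
    off each vertex.  The closed neighbourhood of the tip consists of stem and tip, that of the stem
    contains the rim vertex in addition.  Both sums are odd, so the colour of the rim vertex is even.

  An odd cycle needs three colours (\<open>odd_cycle_needs_three_colours\<close>), so there are three odd colours
  on the ring and three even ones on the rim.  Conversely the colours 1, 3, 5 on the ring and 2, 4, 6
  on the rim, with 1 on the stems and 2 on the tips, meet the sum condition.

  The maximum degree is adjusted by a third component, a star with \<open>\<Delta>\<close> rays whose hub is coloured 1
  and whose rays are coloured 2.  The only cycles of the union are the ring and the rim, so its girth
  is \<open>n\<close>, and it is drawn in the plane with straight edges between lattice points.
\<close>

section \<open>Cyclic sequences of colours\<close>

lemma odd_window_sums_imp_all_odd:
  fixes g :: "nat \<Rightarrow> nat"
  assumes periodic: "\<And>m. g (m + n) = g m"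
    and windows: "\<And>m. odd (g m + g (Suc m) + g (Suc (Suc m)))"
    and "\<not> 3 dvd n"
  shows "odd (g m)"
proof -
  have step3: "odd (g (m + 3)) = odd (g m)" for m
    using windows[of m] windows[of "Suc m"] by (auto simp: numeral_3_eq_3)
  have steps3: "odd (g (m + 3 * q)) = odd (g m)" for m q
  proof (induction q)
    case (Suc q)
    then show ?case using step3[of "m + 3 * q"] by (simp add: algebra_simps)
  qed simp
  have stepsn: "g (m + n * q) = g m" for m q
  proof (induction q)
    case (Suc q)
    then show ?case using periodic[of "m + n * q"] by (simp add: algebra_simps)
  qed simp
  \<comment> \<open>A square that is not divisible by 3 is congruent to 1, so the periods 3 and \<open>n * n\<close>
    combine to the period 1.\<close>
  have "n * n mod 3 = 1"
  proof -
    have "n mod 3 = 1 \<or> n mod 3 = 2"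
      using \<open>\<not> 3 dvd n\<close> by presburger
    then show ?thesis
      by (subst mod_mult_eq[symmetric]) auto
  qed
  then have nn: "n * n = 1 + 3 * (n * n div 3)"
    by presburger
  have step1: "odd (g (Suc m)) = odd (g m)" for m
    using steps3[of "Suc m" "n * n div 3"] stepsn[of m n] nn
    by (metis add.assoc plus_1_eq_Suc add.commute)
  show ?thesis
    using windows[of m] step1[of m] step1[of "Suc m"] by auto
qed

text \<open>With two colours only, the colours along the cycle alternate, so the first and the last
  vertex, which are adjacent, get the same colour when the length is odd.\<close>
lemma odd_cycle_needs_three_colours:
  fixes c :: "nat \<Rightarrow> 'a"
  assumes "odd n"
    and proper: "\<And>i. i < n \<Longrightarrow> c i \<noteq> c (Suc i mod n)"
  shows "3 \<le> card (c ` {..<n})"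
proof (rule ccontr)
  assume "\<not> 3 \<le> card (c ` {..<n})"
  then have le2: "card (c ` {..<n}) \<le> 2"
    by simp
  have "n \<noteq> 1"
    using proper[of 0] by auto
  then have "3 \<le> n"
    using \<open>odd n\<close> by presburger
  have two: "c i = c 0 \<or> c i = c 1" if "i < n" for i
  proof (rule ccontr)
    assume "\<not> ?thesis"
    moreover have "c 0 \<noteq> c 1"
      using proper[of 0] \<open>3 \<le> n\<close> by simp
    ultimately have "card {c 0, c 1, c i} = 3"
      by auto
    moreover have "card {c 0, c 1, c i} \<le> card (c ` {..<n})"
      using that \<open>3 \<le> n\<close> by (intro card_mono) auto
    ultimately show False
      using le2 by simp
  qed
  have alternate: "c i = c (i mod 2)" if "i < n" for i
    using that
  proof (induction i)
    case (Suc i)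
    then have "c i \<noteq> c (Suc i)"
      using proper[of i] by simp
    with Suc two[of "Suc i"] show ?case
      by (cases "even i") (auto simp: mod_Suc odd_iff_mod_2_eq_one)
  qed simp
  have "c (n - 1) = c 0"
    using alternate[of "n - 1"] \<open>odd n\<close> \<open>3 \<le> n\<close> by simp
  then show False
    using proper[of "n - 1"] \<open>3 \<le> n\<close> by simp
qed

definition cycle_colour :: "nat \<Rightarrow> nat \<Rightarrow> nat" where
  "cycle_colour n i = (if Suc i = n then 2 else i mod 2)"

lemma cycle_colour_proper:
  assumes "3 \<le> n" "i < n"
  shows "cycle_colour n i \<noteq> cycle_colour n (Suc i mod n)"
  using assms by (auto simp: cycle_colour_def mod_Suc)

lemma range_cycle_colour:
  assumes "3 \<le> n"
  shows "cycle_colour n ` {..<n} = {0, 1, 2}"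
proof
  show "cycle_colour n ` {..<n} \<subseteq> {0, 1, 2}"
    by (auto simp: cycle_colour_def)
  have "cycle_colour n 0 = 0" "cycle_colour n 1 = 1" "cycle_colour n (n - 1) = 2"
    using assms by (auto simp: cycle_colour_def)
  moreover have "cycle_colour n i \<in> cycle_colour n ` {..<n}" if "i < n" for i
    using that by simp
  ultimately show "{0, 1, 2} \<subseteq> cycle_colour n ` {..<n}"
    using assms by (metis (no_types, lifting) diff_less empty_subsetI insert_subset
        less_le_trans zero_less_numeral zero_less_one one_less_numeral_iff semiring_norm(77))
qed

lemma succ_mod_eq_iff:
  assumes "i < n"
  shows "Suc i mod n = Suc m mod n \<longleftrightarrow> i = m mod n"
    and "Suc m mod n = Suc i mod n \<longleftrightarrow> i = m mod n"
  using assms by (auto simp: mod_Suc split: if_splits)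

lemma ex_succ_mod:
  assumes "i < n"
  obtains m where "i = Suc m mod n"
  using assms by (intro that[of "i + n - 1"]) auto

lemma mod_window_distinct:
  assumes "3 \<le> n"
  shows "m mod n \<noteq> Suc m mod n" "m mod n \<noteq> Suc (Suc m) mod n"
    "Suc m mod n \<noteq> Suc (Suc m) mod n"
  using assms by (auto simp: mod_Suc)

lemma cyclic_induct:
  assumes "P (m mod n)"
    and step: "\<And>m. P (m mod n) \<Longrightarrow> P (Suc m mod n)"
    and "i < n"
  shows "P i"
proof -
  have shifted: "P ((m + j) mod n)" for j
    by (induction j) (use assms(1) step in auto)
  have "m \<le> n * m"
    using \<open>i < n\<close> by (cases n) auto
  then have "m + (i + n * m - m) = i + n * m"
    by linarith
  then show ?thesis
    using shifted[of "i + n * m - m"] \<open>i < n\<close> by simp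
qed

section \<open>Straight-line drawings\<close>

lemma open_segment_coords:
  assumes "z \<in> open_segment a b"
  obtains t where "0 < t" "t < 1" "Re z = Re a + t * (Re b - Re a)" "Im z = Im a + t * (Im b - Im a)"
proof -
  obtain t where t: "0 < t" "t < 1" and z: "z = (1 - t) *\<^sub>R a + t *\<^sub>R b"
    using assms by (auto simp: in_segment)
  have "Re z = Re a + t * (Re b - Re a)" "Im z = Im a + t * (Im b - Im a)"
    unfolding z by (simp_all add: algebra_simps)
  with t show ?thesis
    by (rule that)
qed

lemma not_Ints_between:
  fixes x :: real
  assumes "of_int k < x" "x < of_int k + 1"
  shows "x \<notin> \<int>"
  using assms by (auto elim!: Ints_cases)

lemma pair_graph_arcD:
  assumes "pair_graph G" "(u, v) \<in> parcs G"
  shows "u \<in> pverts G" "v \<in> pverts G" "u \<noteq> v" "(v, u) \<in> parcs G"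
proof -
  interpret pair_graph G by fact
  show "u \<in> pverts G" "v \<in> pverts G" "u \<noteq> v" "(v, u) \<in> parcs G"
    using assms(2) in_arcsD1 in_arcsD2 no_loops' arcs_symmetric by auto
qed

text \<open>
  Disjointness of edges is a statement about all pairs of edges.  A function \<open>loc\<close> that recovers an
  edge from any interior point of its segment reduces it to one check per edge.  The set \<open>L\<close>
  separates the vertices from the interiors of the edges.
\<close>
lemma planar_if_edges_locatable:
  fixes G :: "'a pair_pre_digraph" and pos :: "'a \<Rightarrow> complex"
  assumes G: "pair_graph G"
    and inj: "inj_on pos (pverts G)"
    and vertex: "\<And>v. v \<in> pverts G \<Longrightarrow> pos v \<in> L"
    and edge: "\<And>u v z. (u, v) \<in> parcs G \<Longrightarrow> z \<in> open_segment (pos u) (pos v) \<Longrightarrow>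
      z \<notin> L \<and> loc z = {u, v}"
  shows "planar G"
proof -
  note ends = pair_graph_arcD[OF G]
  have on_edge: "z \<in> closed_segment (pos u) (pos v) \<longleftrightarrow>
      z \<in> open_segment (pos u) (pos v) \<or> z = pos u \<or> z = pos v" for z u v
    by (auto simp: closed_segment_eq_open)
  have pos_eq: "pos u = pos v \<longleftrightarrow> u = v" if "u \<in> pverts G" "v \<in> pverts G" for u v
    using inj that by (auto simp: inj_on_def)
  have arcs: "arc (linepath (pos u) (pos v))" if "(u, v) \<in> parcs G" for u v
    using ends[OF that] pos_eq by (auto intro: arc_linepath)
  have through: "w \<in> {u, v}"
    if "(u, v) \<in> parcs G" "w \<in> pverts G" "pos w \<in> closed_segment (pos u) (pos v)" for u v w
    using that edge[of u v "pos w"] vertex ends[OF that(1)] pos_eq by (auto simp: on_edge)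
  have meet: "z \<in> pos ` ({u, v} \<inter> {x, y})"
    if uv: "(u, v) \<in> parcs G" and xy: "(x, y) \<in> parcs G" and ne: "{u, v} \<noteq> {x, y}"
      and z: "z \<in> closed_segment (pos u) (pos v)" "z \<in> closed_segment (pos x) (pos y)"
    for u v x y z
  proof (cases "z \<in> L")
    case True
    then have "z = pos u \<or> z = pos v"
      using z(1) edge[OF uv] on_edge by blast
    then obtain w where w: "z = pos w" "w \<in> {u, v}"
      by blast
    then have "w \<in> pverts G"
      using ends[OF uv] by blast
    then have "w \<in> {x, y}"
      using through[OF xy] z(2) w(1) by blast
    with w show ?thesis
      by blast
  next
    case False
    then have "z \<in> open_segment (pos u) (pos v)" "z \<in> open_segment (pos x) (pos y)"
      using z vertex ends[OF uv] ends[OF xy] on_edge by blast+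
    then show ?thesis
      using edge[OF uv] edge[OF xy] ne by metis
  qed
  have "plane_drawing G pos (\<lambda>u v. linepath (pos u) (pos v))"
    unfolding plane_drawing_def path_image_linepath
    using inj arcs
    by (fastforce dest: through meet simp: closed_segment_commute)
  then show ?thesis
    unfolding planar_def by blast
qed

section \<open>Vertex sets of cycles\<close>

lemma pawalk_verts_conv: "pcas u p v \<Longrightarrow> pawalk_verts u p = u # map snd p"
  by (induction p arbitrary: u) auto

lemma pcas_consecutive:
  "pcas u p v \<Longrightarrow> Suc i < length p \<Longrightarrow> fst (p ! Suc i) = snd (p ! i)"
proof (induction p arbitrary: u i)
  case (Cons e p)
  then show ?case
    by (cases p; cases i) auto
qed simp

lemma pcas_ends:
  "pcas u p v \<Longrightarrow> p \<noteq> [] \<Longrightarrow> fst (p ! 0) = u \<and> snd (p ! (length p - 1)) = v"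
proof (induction p arbitrary: u)
  case (Cons e p)
  then show ?case
    by (cases p) auto
qed simp

text \<open>
  All that matters about a cycle for bounding the girth is its vertex set: a set with as many elements
  as the cycle is long, in which every vertex has two neighbours.  Without the bound on the length
  the two neighbours could coincide, as in the closed walk along an edge and back.
\<close>
lemma cycle_two_neighbours:
  assumes G: "pair_graph G" and cyc: "pre_digraph.cycle (with_proj G) p" and p: "3 \<le> length p"
  obtains W where "card W = length p" "finite W" "W \<noteq> {}"
    "\<And>w. w \<in> W \<Longrightarrow> \<exists>x y. x \<in> W \<and> y \<in> W \<and> x \<noteq> y \<and> x \<in> nbhd G w \<and> y \<in> nbhd G w"
proof -
  define l where "l = length p"
  have l: "3 \<le> l"
    using p l_def by simp
  interpret pair_graph G by fact
  obtain u where u: "pcas u p u" "set p \<subseteq> parcs G" "distinct (tl (pawalk_verts u p))"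
    using cyc by (auto simp: cycle_def awalk_def)
  then have dist: "distinct (map snd p)"
    by (simp add: pawalk_verts_conv)
  define w where "w i = snd (p ! (i mod l))" for i
  have w_eq: "w i = w j \<longleftrightarrow> i mod l = j mod l" for i j
  proof -
    have "i mod l < l" "j mod l < l"
      using l by simp_all
    then show ?thesis
      using nth_eq_iff_index_eq[OF dist, of "i mod l" "j mod l"] by (simp add: w_def l_def)
  qed
  have arc: "(w i, w (Suc i)) \<in> parcs G" for i
  proof -
    have "fst (p ! (Suc i mod l)) = w i"
    proof (cases "Suc (i mod l) = l")
      case True
      then have "i mod l = l - 1" "p \<noteq> []"
        using l l_def by auto
      then show ?thesis
        using True pcas_ends[OF u(1)] by (simp add: w_def l_def mod_Suc)
    next
      case False
      moreover have "i mod l < l"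
        using l by simp
      ultimately have "Suc (i mod l) < length p"
        unfolding l_def by linarith
      then show ?thesis
        using False pcas_consecutive[OF u(1)] by (simp add: w_def mod_Suc)
    qed
    moreover have "p ! (Suc i mod l) \<in> parcs G"
    proof -
      have "Suc i mod l < length p"
        using l mod_less_divisor[of l "Suc i"] unfolding l_def by linarith
      then show ?thesis
        using u(2) nth_mem by blast
    qed
    ultimately show ?thesis
      by (metis w_def prod.collapse)
  qed
  show ?thesis
  proof (rule that[of "w ` {..<l}"])
    have "inj_on w {..<l}"
      by (auto simp: inj_on_def w_eq)
    then show "card (w ` {..<l}) = length p"
      by (simp add: card_image l_def)
    show "finite (w ` {..<l})" "w ` {..<l} \<noteq> {}"
      using l by (auto simp: lessThan_empty_iff)
  next
    fix v assume "v \<in> w ` {..<l}"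
    then obtain m where m: "v = w (Suc m)"
      by (metis ex_succ_mod imageE lessThan_iff mod_mod_trivial w_eq)
    have in_W: "w i \<in> w ` {..<l}" for i
      using l by (intro image_eqI[of _ _ "i mod l"]) (auto simp: w_eq)
    have "w m \<in> nbhd G v" "w (Suc (Suc m)) \<in> nbhd G v"
      using m arc[of m] arc[of "Suc m"] arcs_symmetric by (auto simp: nbhd_def)
    moreover have "w m \<noteq> w (Suc (Suc m))"
      using mod_window_distinct[OF l] by (auto simp: w_eq)
    ultimately show "\<exists>x y. x \<in> w ` {..<l} \<and> y \<in> w ` {..<l} \<and> x \<noteq> y \<and> x \<in> nbhd G v \<and> y \<in> nbhd G v"
      using in_W by blast
  qed
qed

section \<open>The graph\<close>

text \<open>The pairing function makes the natural numbers serve as tagged vertices; the tag is the first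
  component.\<close>

abbreviation "ring i \<equiv> prod_encode (0, i)"
abbreviation "rim i \<equiv> prod_encode (Suc 0, i)"
abbreviation "stem i \<equiv> prod_encode (2, i)"
abbreviation "tip i \<equiv> prod_encode (3, i)"
abbreviation "hub \<equiv> prod_encode (4, 0)"
abbreviation "ray j \<equiv> prod_encode (5, j)"

definition oriented_edges :: "nat \<Rightarrow> nat \<Rightarrow> nat rel" where
  "oriented_edges n d =
     {(ring i, ring (Suc i mod n)) | i. i < n} \<union>
     {(rim i, rim (Suc i mod n)) | i. i < n} \<union>
     {(rim i, stem i) | i. i < n} \<union> {(stem i, tip i) | i. i < n} \<union>
     {(hub, ray j) | j. j < d}"

definition ring_sun_star :: "nat \<Rightarrow> nat \<Rightarrow> nat pair_pre_digraph" where
  "ring_sun_star n d =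
     \<lparr>pverts = ring ` {..<n} \<union> rim ` {..<n} \<union> stem ` {..<n} \<union> tip ` {..<n} \<union> {hub} \<union> ray ` {..<d},
      parcs = oriented_edges n d \<union> (oriented_edges n d)\<inverse>\<rparr>"

context
  fixes n d :: nat
  assumes n: "3 \<le> n"
begin

abbreviation "\<G> \<equiv> ring_sun_star n d"

lemma n_pos: "0 < n" "m mod n < n"
  using n by auto

lemma pverts_cases:
  assumes "v \<in> pverts \<G>"
  obtains (ring) m where "v = ring (Suc m mod n)" | (rim) m where "v = rim (Suc m mod n)"
    | (stem) i where "v = stem i" "i < n" | (tip) i where "v = tip i" "i < n"
    | (hub) "v = hub" | (ray) j where "v = ray j" "j < d"
  using assms unfolding ring_sun_star_def by (auto elim: ex_succ_mod)

lemma pair_graph_ring_sun_star: "pair_graph \<G>"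
proof -
  have fin: "finite (oriented_edges n d)"
    by (auto simp: oriented_edges_def)
  have wf: "u \<in> pverts \<G> \<and> v \<in> pverts \<G> \<and> u \<noteq> v" if "(u, v) \<in> oriented_edges n d" for u v
    using that n by (auto simp: oriented_edges_def ring_sun_star_def mod_Suc split: if_splits)
  show ?thesis
  proof
    show "symmetric (with_proj \<G>)"
      by (auto simp: symmetric_def ring_sun_star_def sym_Un_converse)
    show "finite (parcs \<G>)"
      using fin by (simp add: ring_sun_star_def)
    show "finite (pverts \<G>)"
      by (simp add: ring_sun_star_def)
    fix e assume "e \<in> parcs \<G>"
    then show "fst e \<in> pverts \<G>" "snd e \<in> pverts \<G>" "fst e \<noteq> snd e"
      using wf[of "fst e" "snd e"] wf[of "snd e" "fst e"]
      by (cases e; auto simp: ring_sun_star_def; fail)+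
  qed
qed

text \<open>Writing a vertex of a cycle as \<open>Suc m mod n\<close> gives both its neighbours without a
  subtraction or a case distinction at the seam.\<close>
lemma nbhd_ring: "nbhd \<G> (ring (Suc m mod n)) = {ring (m mod n), ring (Suc (Suc m) mod n)}"
  using n_pos
  by (auto simp: nbhd_def ring_sun_star_def oriented_edges_def succ_mod_eq_iff mod_Suc_eq)

lemma nbhd_rim:
  "nbhd \<G> (rim (Suc m mod n)) = {rim (m mod n), rim (Suc (Suc m) mod n), stem (Suc m mod n)}"
  using n_pos
  by (auto simp: nbhd_def ring_sun_star_def oriented_edges_def succ_mod_eq_iff mod_Suc_eq)

lemma nbhd_stem: "i < n \<Longrightarrow> nbhd \<G> (stem i) = {rim i, tip i}"
  by (auto simp: nbhd_def ring_sun_star_def oriented_edges_def)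

lemma nbhd_tip: "i < n \<Longrightarrow> nbhd \<G> (tip i) = {stem i}"
  by (auto simp: nbhd_def ring_sun_star_def oriented_edges_def)

lemma nbhd_hub: "nbhd \<G> hub = ray ` {..<d}"
  by (auto simp: nbhd_def ring_sun_star_def oriented_edges_def)

lemma nbhd_ray: "j < d \<Longrightarrow> nbhd \<G> (ray j) = {hub}"
  by (auto simp: nbhd_def ring_sun_star_def oriented_edges_def)

lemmas nbhds = nbhd_ring nbhd_rim nbhd_stem nbhd_tip nbhd_hub nbhd_ray

lemma max_degree_ring_sun_star:
  assumes "3 \<le> d"
  shows "max_degree \<G> = d"
  unfolding max_degree_def
proof (rule Max_eqI)
  show "finite ((\<lambda>v. card (nbhd \<G> v)) ` pverts \<G>)"
    by (simp add: ring_sun_star_def)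
  have hub_degree: "card (nbhd \<G> hub) = d"
    by (simp add: nbhd_hub card_image inj_on_def)
  then show "d \<in> (\<lambda>v. card (nbhd \<G> v)) ` pverts \<G>"
    by (force simp: ring_sun_star_def)
  fix a assume "a \<in> (\<lambda>v. card (nbhd \<G> v)) ` pverts \<G>"
  then obtain v where v: "v \<in> pverts \<G>" "a = card (nbhd \<G> v)"
    by blast
  from v(1) show "a \<le> d"
    by (cases rule: pverts_cases)
      (use \<open>3 \<le> d\<close> hub_degree v(2) in \<open>auto simp: nbhds card_insert_if\<close>)
qed

text \<open>
  Repeatedly discarding vertices with at most one remaining neighbour removes the tips, then the
  stems, and likewise the rays and then the hub.  What is left of a cycle lies in the ring and the
  rim, where two neighbours within the cycle mean both neighbours, so it goes all the way round.
\<close>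
lemma length_cycle_ring_sun_star:
  assumes "pre_digraph.cycle (with_proj \<G>) p" "3 \<le> length p"
  shows "n \<le> length p"
proof -
  obtain W where W: "card W = length p" "finite W" "W \<noteq> {}"
    and two: "\<And>w. w \<in> W \<Longrightarrow> \<exists>x y. x \<in> W \<and> y \<in> W \<and> x \<noteq> y \<and> x \<in> nbhd \<G> w \<and> y \<in> nbhd \<G> w"
    using cycle_two_neighbours[OF pair_graph_ring_sun_star assms] by blast
  have sub: "W \<subseteq> pverts \<G>"
    using two pair_graph_arcD(1)[OF pair_graph_ring_sun_star] unfolding nbhd_def by blast
  have no_tip: "tip i \<notin> W" if "i < n" for i
    using two[of "tip i"] nbhd_tip[OF that] by auto
  have no_stem: "stem i \<notin> W" if "i < n" for i
    using two[of "stem i"] nbhd_stem[OF that] no_tip[OF that] by auto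
  have no_ray: "ray j \<notin> W" if "j < d" for j
    using two[of "ray j"] nbhd_ray[OF that] by auto
  have no_hub: "hub \<notin> W"
    using two[of hub] no_ray by (auto simp: nbhd_hub)
  have whole: "n \<le> length p" if "c ` {..<n} \<subseteq> W" "inj_on c {..<n}" for c
    using card_mono[OF W(2) that(1)] card_image[OF that(2)] W(1) by simp
  obtain w where w: "w \<in> W"
    using W(3) by blast
  then have "w \<in> pverts \<G>"
    using sub by blast
  then show ?thesis
  proof (cases rule: pverts_cases)
    case (ring m)
    have "ring i \<in> W" if "i < n" for i
    proof (rule cyclic_induct[where P = "\<lambda>i. ring i \<in> W", OF _ _ that])
      show "ring (Suc m mod n) \<in> W"
        using ring w by simp
      fix m assume "ring (m mod n) \<in> W"
      moreover obtain m' where m': "m mod n = Suc m' mod n"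
        using ex_succ_mod[of "m mod n" n] n_pos by metis
      ultimately have "ring (Suc (Suc m') mod n) \<in> W"
        using two[of "ring (Suc m' mod n)"] by (auto simp: nbhd_ring)
      then show "ring (Suc m mod n) \<in> W"
        using m' by (metis mod_Suc_eq)
    qed
    then show ?thesis
      by (intro whole[of "\<lambda>i. ring i"]) (auto simp: inj_on_def)
  next
    case (rim m)
    have "rim i \<in> W" if "i < n" for i
    proof (rule cyclic_induct[where P = "\<lambda>i. rim i \<in> W", OF _ _ that])
      show "rim (Suc m mod n) \<in> W"
        using rim w by simp
      fix m assume "rim (m mod n) \<in> W"
      moreover obtain m' where m': "m mod n = Suc m' mod n"
        using ex_succ_mod[of "m mod n" n] n_pos by metis
      ultimately have "rim (Suc (Suc m') mod n) \<in> W"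
        using two[of "rim (Suc m' mod n)"] no_stem n_pos by (auto simp: nbhd_rim)
      then show "rim (Suc m mod n) \<in> W"
        using m' by (metis mod_Suc_eq)
    qed
    then show ?thesis
      by (intro whole[of "\<lambda>i. rim i"]) (auto simp: inj_on_def)
  qed (use w no_stem no_tip no_ray no_hub in auto)
qed

section \<open>The odd-sum chromatic number\<close>

lemma closed_nbhd_sums:
  fixes f :: "nat \<Rightarrow> nat"
  shows "sum f (closed_nbhd \<G> (ring (Suc m mod n))) =
      f (ring (m mod n)) + f (ring (Suc m mod n)) + f (ring (Suc (Suc m) mod n))"
    and "sum f (closed_nbhd \<G> (rim (Suc m mod n))) =
      f (rim (m mod n)) + f (rim (Suc m mod n)) + f (rim (Suc (Suc m) mod n)) + f (stem (Suc m mod n))"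
    and "i < n \<Longrightarrow> sum f (closed_nbhd \<G> (stem i)) = f (rim i) + f (stem i) + f (tip i)"
    and "i < n \<Longrightarrow> sum f (closed_nbhd \<G> (tip i)) = f (stem i) + f (tip i)"
    and "sum f (closed_nbhd \<G> hub) = f hub + (\<Sum>j<d. f (ray j))"
    and "j < d \<Longrightarrow> sum f (closed_nbhd \<G> (ray j)) = f hub + f (ray j)"
  using mod_window_distinct[OF n, of m]
  by (auto simp: closed_nbhd_def nbhds sum.insert_if sum.reindex inj_on_def image_iff)

lemma odd_sum_coloring_ring_odd:
  assumes "odd_sum_coloring \<G> f" "\<not> 3 dvd n" "i < n"
  shows "odd (f (ring i))"
proof -
  have "odd (sum f (closed_nbhd \<G> (ring (Suc m mod n))))" for m
    using assms(1) n_pos by (auto simp: odd_sum_coloring_def ring_sun_star_def)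
  then have "odd (f (ring (i mod n)))"
    using \<open>\<not> 3 dvd n\<close>
    by (intro odd_window_sums_imp_all_odd[where n = n and g = "\<lambda>m. f (ring (m mod n))"])
      (auto simp: closed_nbhd_sums)
  then show ?thesis
    using \<open>i < n\<close> by simp
qed

text \<open>The closed neighbourhoods of a stem and of its tip differ by the rim vertex alone.\<close>
lemma odd_sum_coloring_rim_even:
  assumes "odd_sum_coloring \<G> f" "i < n"
  shows "even (f (rim i))"
proof -
  have "odd (sum f (closed_nbhd \<G> (stem i)))" "odd (sum f (closed_nbhd \<G> (tip i)))"
    using assms by (auto simp: odd_sum_coloring_def ring_sun_star_def)
  then show ?thesis
    using \<open>i < n\<close> by (auto simp: closed_nbhd_sums)
qed

lemma odd_sum_coloring_ge_6:
  assumes f: "odd_sum_coloring \<G> f" and "\<not> 3 dvd n" "odd n"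
  shows "6 \<le> card (f ` pverts \<G>)"
proof -
  let ?A = "(\<lambda>i. f (ring i)) ` {..<n}" and ?B = "(\<lambda>i. f (rim i)) ` {..<n}"
  have proper: "f u \<noteq> f v" if "(u, v) \<in> oriented_edges n d" for u v
    using f that by (auto simp: odd_sum_coloring_def coloring_def ring_sun_star_def)
  have "3 \<le> card ?A" "3 \<le> card ?B"
    by (intro odd_cycle_needs_three_colours \<open>odd n\<close> proper; force simp: oriented_edges_def)+
  moreover have "?A \<inter> ?B = {}"
    using odd_sum_coloring_ring_odd[OF f \<open>\<not> 3 dvd n\<close>] odd_sum_coloring_rim_even[OF f]
    by (fastforce simp: disjoint_iff)
  then have "card (?A \<union> ?B) = card ?A + card ?B"
    by (intro card_Un_disjoint) auto
  moreover have "card (?A \<union> ?B) \<le> card (f ` pverts \<G>)"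
    by (intro card_mono) (auto simp: ring_sun_star_def)
  ultimately show ?thesis
    by linarith
qed

text \<open>At a ring vertex three odd colours add up; at every other vertex exactly one term of the sum
  is odd, namely a stem or the hub.\<close>
definition six_colouring :: "nat \<Rightarrow> nat" where
  "six_colouring v = (case prod_decode v of (t, i) \<Rightarrow>
     if t = 0 then 2 * cycle_colour n i + 1
     else if t = 1 then 2 * cycle_colour n i + 2
     else if t = 2 \<or> t = 4 then 1 else 2)"

lemma six_colouring_simps [simp]:
  "six_colouring (ring i) = 2 * cycle_colour n i + 1"
  "six_colouring (rim i) = 2 * cycle_colour n i + 2"
  "six_colouring (stem i) = 1" "six_colouring (tip i) = 2"
  "six_colouring hub = 1" "six_colouring (ray j) = 2"
  by (auto simp: six_colouring_def)

lemma six_colouring_odd_sum: "odd_sum_coloring \<G> six_colouring"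
  unfolding odd_sum_coloring_def coloring_def
proof (intro conjI ballI)
  fix v assume "v \<in> pverts \<G>"
  then show "0 < six_colouring v" "odd (sum six_colouring (closed_nbhd \<G> v))"
    by (cases rule: pverts_cases; simp add: closed_nbhd_sums)+
next
  have "six_colouring u \<noteq> six_colouring v" if "(u, v) \<in> oriented_edges n d" for u v
    using that by (auto simp: oriented_edges_def cycle_colour_proper[OF n])
  moreover fix e assume "e \<in> parcs \<G>"
  ultimately show "case e of (u, v) \<Rightarrow> six_colouring u \<noteq> six_colouring v"
    by (cases e) (simp add: ring_sun_star_def, metis)
qed

lemma card_six_colouring: "card (six_colouring ` pverts \<G>) = 6"
proof -
  have "six_colouring ` pverts \<G> = {1, 3, 5, 2, 4, 6}"
  proof
    have three: "cycle_colour n i = 0 \<or> cycle_colour n i = 1 \<or> cycle_colour n i = 2" for i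
      by (auto simp: cycle_colour_def)
    show "six_colouring ` pverts \<G> \<subseteq> {1, 3, 5, 2, 4, 6}"
    proof (rule image_subsetI)
      fix v assume "v \<in> pverts \<G>"
      then show "six_colouring v \<in> {1, 3, 5, 2, 4, 6}"
      proof (cases rule: pverts_cases)
        case (ring m)
        then show ?thesis
          using three[of "Suc m mod n"] by auto
      next
        case (rim m)
        then show ?thesis
          using three[of "Suc m mod n"] by auto
      qed auto
    qed
    have "{1, 3, 5, 2, 4, 6} = (\<lambda>c. 2 * c + 1) ` cycle_colour n ` {..<n} \<union>
        (\<lambda>c. 2 * c + 2) ` cycle_colour n ` {..<n}"
      unfolding range_cycle_colour[OF n] by auto
    also have "\<dots> = six_colouring ` (ring ` {..<n} \<union> rim ` {..<n})"
      by (simp add: image_Un image_image)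
    also have "\<dots> \<subseteq> six_colouring ` pverts \<G>"
      by (auto simp: ring_sun_star_def)
    finally show "{1, 3, 5, 2, 4, 6} \<subseteq> six_colouring ` pverts \<G>" .
  qed
  then show ?thesis
    by simp
qed

lemma odd_sum_chromatic_number_ring_sun_star:
  assumes "\<not> 3 dvd n" "odd n"
  shows "odd_sum_chromatic_number \<G> = 6"
  unfolding odd_sum_chromatic_number_def
proof (rule cInf_eq_minimum)
  show "6 \<in> {card (f ` pverts \<G>) | f. odd_sum_coloring \<G> f}"
    using six_colouring_odd_sum card_six_colouring by force
qed (use odd_sum_coloring_ge_6 assms in auto)


section \<open>Drawing the graph\<close>

text \<open>
  Each cycle lies on a horizontal line except for its last vertex, which is put one unit above the
  first one; its last two edges then form the other two sides of a triangle.  The stems and tips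
  of the rim point downwards from the line and upwards from the apex of the triangle.  The rim, the ring and
  the star occupy disjoint vertical strips.
\<close>
definition cycle_pos :: "nat \<Rightarrow> complex" where
  "cycle_pos i = (if Suc i = n then Complex 0 1 else Complex (real i) 0)"

definition position :: "nat \<Rightarrow> complex" where
  "position v = (case prod_decode v of (t, i) \<Rightarrow>
     if t = 0 then cycle_pos i + Complex (real n) 0
     else if t = 1 then cycle_pos i
     else if t = 2 then cycle_pos i + Complex 0 (if Suc i = n then 1 else - 1)
     else if t = 3 then cycle_pos i + Complex 0 (if Suc i = n then 2 else - 2)
     else if t = 4 then Complex (- 1) 0
     else Complex (- 2) (real i))"

lemma position_simps [simp]:
  "position (ring i) = cycle_pos i + Complex (real n) 0"
  "position (rim i) = cycle_pos i"
  "position (stem i) = cycle_pos i + Complex 0 (if Suc i = n then 1 else - 1)"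
  "position (tip i) = cycle_pos i + Complex 0 (if Suc i = n then 2 else - 2)"
  "position hub = Complex (- 1) 0"
  "position (ray j) = Complex (- 2) (real j)"
  by (simp_all add: position_def)

text \<open>The edge of a cycle through a point, read off from its coordinates: the edges on the line,
  the vertical one and the slanted one.\<close>
definition cycle_edge_at :: "(nat \<Rightarrow> nat) \<Rightarrow> complex \<Rightarrow> nat set" where
  "cycle_edge_at c z =
     (if Im z = 0 then {c (nat \<lfloor>Re z\<rfloor>), c (Suc (nat \<lfloor>Re z\<rfloor>))}
      else if Re z = 0 then {c (n - 1), c 0} else {c (n - 2), c (n - 1)})"

text \<open>A ray is determined by its slope, which is its index up to sign.  Points with imaginary part
  above 1 over the rim belong to the stem or the tip at the apex, hence to index \<open>n - 1\<close>.\<close>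
definition edge_at :: "complex \<Rightarrow> nat set" where
  "edge_at z =
     (let i = nat \<lfloor>Re z\<rfloor> in
      if Re z < - 1 then {hub, ray (nat \<lfloor>Im z / (- 1 - Re z)\<rfloor>)}
      else if real n \<le> Re z then cycle_edge_at (\<lambda>i. ring i) (z - Complex (real n) 0)
      else if Im z < - 1 then {stem i, tip i}
      else if Im z < 0 then {rim i, stem i}
      else if Im z \<le> 1 then cycle_edge_at (\<lambda>i. rim i) z
      else if Im z < 2 then {rim (n - 1), stem (n - 1)}
      else {stem (n - 1), tip (n - 1)})"

definition lattice :: "complex set" where
  "lattice = {z. Re z \<in> \<int> \<and> Im z \<in> \<int>}"

lemma cycle_pos_coords:
  "i < n \<Longrightarrow> Re (cycle_pos i) \<in> \<int> \<and> Im (cycle_pos i) \<in> \<int> \<and> 0 \<le> Re (cycle_pos i) \<and>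
     Re (cycle_pos i) \<le> real n - 2"
  using n by (auto simp: cycle_pos_def)

lemma position_lattice: "v \<in> pverts \<G> \<Longrightarrow> position v \<in> lattice"
  by (auto simp: ring_sun_star_def lattice_def cycle_pos_coords)

lemma inj_on_position: "inj_on position (pverts \<G>)"
  unfolding inj_on_def ring_sun_star_def
  by (auto simp: cycle_pos_def complex_eq_iff split: if_splits)

lemma cycle_edge_at_correct:
  assumes "i < n" "z \<in> open_segment (cycle_pos i) (cycle_pos (Suc i mod n))"
  shows "z \<notin> lattice" "0 \<le> Re z" "Re z \<le> real n - 2" "0 \<le> Im z" "Im z \<le> 1"
    "cycle_edge_at c z = {c i, c (Suc i mod n)}"
proof -
  obtain t where t: "0 < t" "t < 1"
    and z: "Re z = Re (cycle_pos i) + t * (Re (cycle_pos (Suc i mod n)) - Re (cycle_pos i))"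
      "Im z = Im (cycle_pos i) + t * (Im (cycle_pos (Suc i mod n)) - Im (cycle_pos i))"
    using open_segment_coords[OF assms(2)] by blast
  have t_frac: "t \<notin> \<int>" "1 - t \<notin> \<int>"
    using t not_Ints_between[of 0] by auto
  consider "Suc (Suc i) < n" | "Suc (Suc i) = n" | "Suc i = n"
    using \<open>i < n\<close> by linarith
  then have "z \<notin> lattice \<and> 0 \<le> Re z \<and> Re z \<le> real n - 2 \<and> 0 \<le> Im z \<and> Im z \<le> 1 \<and>
    cycle_edge_at c z = {c i, c (Suc i mod n)}"
  proof cases
    case 1
    then have "Re z = real i + t" "Im z = 0"
      using z n by (auto simp: cycle_pos_def)
    moreover have "real i + t \<notin> \<int>"
      using t not_Ints_between[of "int i"] by auto
    moreover have "nat \<lfloor>real i + t\<rfloor> = i"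
      using t by linarith
    moreover have "real i + 1 \<le> real n - 2"
      using 1 by linarith
    ultimately show ?thesis
      using 1 t by (auto simp: lattice_def cycle_edge_at_def)
  next
    case 2
    then have "Re z = (1 - t) * (real n - 2)" "Im z = t"
      using z n by (auto simp: cycle_pos_def algebra_simps)
    moreover have "0 < real n - 2"
      using n by linarith
    moreover have "(1 - t) * (real n - 2) \<le> real n - 2"
      using t n by (simp add: mult_left_le_one_le)
    ultimately show ?thesis
      using 2 t t_frac by (auto simp: lattice_def cycle_edge_at_def)
  next
    case 3
    then have "Re z = 0" "Im z = 1 - t"
      using z n by (auto simp: cycle_pos_def)
    then show ?thesis
      using 3 t t_frac n by (auto simp: lattice_def cycle_edge_at_def)
  qed
  then show "z \<notin> lattice" "0 \<le> Re z" "Re z \<le> real n - 2" "0 \<le> Im z" "Im z \<le> 1"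
    "cycle_edge_at c z = {c i, c (Suc i mod n)}"
    by auto
qed

lemma edge_at_correct:
  assumes "(u, v) \<in> oriented_edges n d" "z \<in> open_segment (position u) (position v)"
  shows "z \<notin> lattice \<and> edge_at z = {u, v}"
proof -
  obtain t where t: "0 < t" "t < 1"
    and z: "Re z = Re (position u) + t * (Re (position v) - Re (position u))"
      "Im z = Im (position u) + t * (Im (position v) - Im (position u))"
    using open_segment_coords[OF assms(2)] by blast
  have frac: "of_int k + t \<notin> \<int>" "of_int k - t \<notin> \<int>" for k
    using t not_Ints_between[of k] not_Ints_between[of "k - 1"] by auto
  consider (ring) i where "i < n" "u = ring i" "v = ring (Suc i mod n)"
    | (rim) i where "i < n" "u = rim i" "v = rim (Suc i mod n)"
    | (stem) i where "i < n" "u = rim i" "v = stem i"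
    | (tip) i where "i < n" "u = stem i" "v = tip i"
    | (ray) j where "u = hub" "v = ray j"
    using assms(1) by (auto simp: oriented_edges_def)
  then show ?thesis
  proof cases
    case ring
    let ?z = "z - Complex (real n) 0"
    have "?z \<in> open_segment (cycle_pos i) (cycle_pos (Suc i mod n))"
      using assms(2) ring
        open_segment_translation_eq[of "Complex (real n) 0" ?z "cycle_pos i" "cycle_pos (Suc i mod n)"]
      by (simp add: add.commute)
    note z' = cycle_edge_at_correct[OF \<open>i < n\<close> this]
    have "z \<notin> lattice"
      using z'(1) by (auto simp: lattice_def)
    then show ?thesis
      using z'(2,6) ring by (simp add: edge_at_def)
  next
    case rim
    note z' = cycle_edge_at_correct[OF \<open>i < n\<close>, of z]
    show ?thesis
      using z' assms(2) rim by (simp add: edge_at_def)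
  next
    case stem
    show ?thesis
    proof (cases "Suc i = n")
      case True
      then have "Re z = 0" "Im z = 1 + t"
        using z stem by (auto simp: cycle_pos_def)
      then show ?thesis
        using t frac[of 1] True stem n by (auto simp: lattice_def edge_at_def)
    next
      case False
      then have "Re z = real i" "Im z = - t"
        using z stem by (auto simp: cycle_pos_def)
      then show ?thesis
        using t frac[of 0] False stem n by (auto simp: lattice_def edge_at_def)
    qed
  next
    case tip
    show ?thesis
    proof (cases "Suc i = n")
      case True
      then have "Re z = 0" "Im z = 2 + t"
        using z tip by (auto simp: cycle_pos_def)
      then show ?thesis
        using t frac[of 2] True tip n by (auto simp: lattice_def edge_at_def)
    next
      case False
      then have "Re z = real i" "Im z = - 1 - t"
        using z tip by (auto simp: cycle_pos_def)
      then show ?thesis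
        using t frac[of "-1"] False tip n by (auto simp: lattice_def edge_at_def)
    qed
  next
    case ray
    then have "Re z = - 1 - t" "Im z = t * real j"
      using z by auto
    then show ?thesis
      using t frac[of "-1"] ray by (auto simp: lattice_def edge_at_def)
  qed
qed

lemma planar_ring_sun_star: "planar \<G>"
proof (rule planar_if_edges_locatable[OF pair_graph_ring_sun_star inj_on_position position_lattice])
  fix u v z assume "(u, v) \<in> parcs \<G>" and z: "z \<in> open_segment (position u) (position v)"
  then consider "(u, v) \<in> oriented_edges n d" | "(v, u) \<in> oriented_edges n d"
    by (auto simp: ring_sun_star_def)
  then show "z \<notin> lattice \<and> edge_at z = {u, v}"
    using edge_at_correct z by cases (metis, metis open_segment_commute insert_commute)
qed

end

theorem theorem1:
  fixes k \<Delta> :: nat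
  assumes "k \<ge> 1" and "\<Delta> \<ge> 4" and "even \<Delta>"
  shows "\<exists>J :: nat pair_pre_digraph.
           pair_graph J \<and> planar J \<and> max_degree J = \<Delta> \<and> girth J \<ge> enat k \<and>
           odd_sum_chromatic_number J = 6"
proof -
  \<comment> \<open>Coprime to 6 and at least \<open>k\<close>.\<close>
  define n where "n = 6 * k + 1"
  have n: "3 \<le> n" "k \<le> n" "odd n" "\<not> 3 dvd n"
    using \<open>k \<ge> 1\<close> unfolding n_def by presburger+
  let ?J = "ring_sun_star n \<Delta>"
  have "girth ?J \<ge> enat k"
    unfolding girth_def
    using length_cycle_ring_sun_star[OF n(1)] n(2) by (fastforce intro!: Inf_greatest)
  moreover have "max_degree ?J = \<Delta>"
    using max_degree_ring_sun_star[OF n(1)] \<open>\<Delta> \<ge> 4\<close> by simp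
  ultimately show ?thesis
    using pair_graph_ring_sun_star[OF n(1)] planar_ring_sun_star[OF n(1)] odd_sum_chromatic_number_ring_sun_star[OF n(1) n(4,3)]
    by blast
qed

end
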